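(* Let $E$ be a Banach lattice failing the disjoint Grothendieck property. Then the set of norm bounded disjoint non-weakly null $E^*$-valued sequences is almost positive pointwise latticeable in $\ell_\infty(E^* )$.
   Context: Banach lattices are real; $E^*$ is the topological dual of $E$, a Banach lattice. A Banach lattice has the disjoint Grothendieck property if norm bounded disjoint sequences in its dual are weakly null. A sequence $(x_j)_{j=1}^\infty$ in a Banach lattice is disjoint if $|x_j| \wedge |x_k| = 0$ for $j \neq k$. $\ell_\infty(E^* )$ is the Banach lattice of bounded $E^*$-valued sequences with the supremum norm and the pointwise ordering; $X^+$ denotes the positive cone of a Banach lattice $X$. A Banach sequence lattice is a linear subspace $X$ of $G^{\mathbb{N}}$, $G$ a Banach lattice, endowed with a complete norm that makes $X$ a Banach lattice with the pointwise ordering. A subset $B$ of a Banach sequence lattice $X$ with $B \cap X^+ \neq \emptyset$ is almost positive pointwise latticeable (in $X$) if for each positive sequence $\mathbf{x} \in B$ there exists a closed infinite dimensional sublattice of $X$ contained in $B \cup \{0\}$ and containing a subsequence of $\mathbf{x}$. *)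

theory Defs
  imports
    "HOL-Analysis.Analysis"
    "HOL-Library.Lattice_Algebras"
    "HOL-Library.Function_Algebras"
begin

section \<open>Banach lattices\<close>

text \<open>The classes \<open>lattice_ab_group_add_abs\<close> and \<open>ordered_real_vector\<close> together are the real
  vector lattices, with \<open>\<bar>x\<bar> = sup x (- x)\<close>.\<close>

class banach_lattice = banach + ordered_real_vector + lattice_ab_group_add_abs +
  assumes norm_mono_abs: "\<bar>x\<bar> \<le> \<bar>y\<bar> \<Longrightarrow> norm x \<le> norm y"

instance real :: banach_lattice
  by standard simp

lemma banach_lattice_norm_le:
  fixes x y :: "'a::banach_lattice"
  assumes "0 \<le> x" "x \<le> y"
  shows "norm x \<le> norm y"
proof -
  have "0 \<le> y" using assms by order
  then show ?thesis using assms by (intro norm_mono_abs) simp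
qed

lemma banach_lattice_norm_abs [simp]:
  fixes x :: "'a::banach_lattice"
  shows "norm \<bar>x\<bar> = norm x"
  by (intro antisym norm_mono_abs) simp_all


section \<open>The dual of a Banach lattice\<close>

subsection \<open>The Riesz--Kantorovich positive part of a functional\<close>

lemma riesz_decomposition:
  fixes y a b :: "'a::banach_lattice"
  assumes "0 \<le> a" "0 \<le> b" "0 \<le> y" "y \<le> a + b"
  obtains y1 y2 where "y = y1 + y2" "0 \<le> y1" "y1 \<le> a" "0 \<le> y2" "y2 \<le> b"
proof
  show "y = inf y a + (y - inf y a)" by (metis add.commute diff_add_cancel)
  show "0 \<le> inf y a" "inf y a \<le> a" using assms by simp_all
  have "inf y a \<le> y" by simp
  then show "0 \<le> y - inf y a" by (simp only: diff_ge_0_iff_ge)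
  have "y - b \<le> inf y a" using assms by (simp add: diff_le_eq)
  then show "y - inf y a \<le> b" by (metis add.commute diff_le_eq)
qed

lemma pos_diff:
  fixes x :: "'a::banach_lattice"
  shows "x = pprt x - pprt (- x)"
  using prts[of x] by (simp add: pprt_neg)

lemma positive_part_functional:
  fixes D :: "'a::banach_lattice \<Rightarrow>\<^sub>L real"
  obtains K :: "'a \<Rightarrow>\<^sub>L real" where
    "\<And>y u. 0 \<le> y \<Longrightarrow> y \<le> u \<Longrightarrow> blinfun_apply D y \<le> blinfun_apply K u"
    "\<And>u c. 0 \<le> u \<Longrightarrow> (\<And>y. 0 \<le> y \<Longrightarrow> y \<le> u \<Longrightarrow> blinfun_apply D y \<le> c) \<Longrightarrow> blinfun_apply K u \<le> c"
proof -
  define q where "q u = (SUP y\<in>{0..u}. blinfun_apply D y)" for u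
  define L where "L x = q (pprt x) - q (pprt (- x))" for x
  have Dle: "blinfun_apply D y \<le> norm D * norm u" if "0 \<le> y" "y \<le> u" for y u
  proof -
    have "blinfun_apply D y \<le> norm D * norm y" using norm_blinfun[of D y] by simp
    also have "\<dots> \<le> norm D * norm u"
      by (intro mult_left_mono banach_lattice_norm_le that) simp
    finally show ?thesis .
  qed
  have bdd: "bdd_above (blinfun_apply D ` {0..u})" for u
    by (rule bdd_aboveI[where M = "norm D * norm u"]) (auto intro: Dle)
  have upper: "blinfun_apply D y \<le> q u" if "0 \<le> y" "y \<le> u" for y u
    unfolding q_def using that by (intro cSUP_upper bdd) auto
  have least: "q u \<le> c" if "0 \<le> u" "\<And>y. 0 \<le> y \<Longrightarrow> y \<le> u \<Longrightarrow> blinfun_apply D y \<le> c" for u c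
    unfolding q_def using that by (intro cSUP_least) auto
  have q0: "0 \<le> q u" if "0 \<le> u" for u
    using upper[of 0 u] that by (simp add: blinfun.zero_right)
  have add: "q (a + b) = q a + q b" if ab: "0 \<le> a" "0 \<le> b" for a b
  proof (rule antisym)
    show "q (a + b) \<le> q a + q b"
    proof (rule least)
      show "0 \<le> a + b" using ab by simp
      fix y assume y: "0 \<le> y" "y \<le> a + b"
      obtain y1 y2 where "y = y1 + y2" "0 \<le> y1" "y1 \<le> a" "0 \<le> y2" "y2 \<le> b"
        using riesz_decomposition[OF ab y] .
      then show "blinfun_apply D y \<le> q a + q b"
        using upper[of y1 a] upper[of y2 b] by (simp add: blinfun.add_right)
    qed
    have "q b \<le> q (a + b) - q a"
    proof (rule least)
      fix z assume z: "0 \<le> z" "z \<le> b"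
      have "q a \<le> q (a + b) - blinfun_apply D z"
      proof (rule least)
        fix y assume "0 \<le> y" "y \<le> a"
        then have "blinfun_apply D (y + z) \<le> q (a + b)"
          using z by (intro upper add_mono add_nonneg_nonneg)
        then show "blinfun_apply D y \<le> q (a + b) - blinfun_apply D z"
          by (simp add: blinfun.add_right)
      qed (use ab in simp)
      then show "blinfun_apply D z \<le> q (a + b) - q a" by simp
    qed (use ab in simp)
    then show "q a + q b \<le> q (a + b)" by simp
  qed
  have scale_le: "q (c *\<^sub>R u) \<le> c * q u" if c: "0 < c" and u: "0 \<le> u" for c u
  proof (rule least)
    show "0 \<le> c *\<^sub>R u" using c u by (simp add: scaleR_nonneg_nonneg)
    fix y assume y: "0 \<le> y" "y \<le> c *\<^sub>R u"
    have "(1 / c) *\<^sub>R y \<le> (1 / c) *\<^sub>R (c *\<^sub>R u)"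
      using y(2) c by (intro scaleR_left_mono) simp_all
    then have "blinfun_apply D ((1 / c) *\<^sub>R y) \<le> q u"
      using c y(1) by (intro upper) (simp_all add: scaleR_nonneg_nonneg)
    then show "blinfun_apply D y \<le> c * q u"
      using c by (simp add: blinfun.scaleR_right field_simps)
  qed
  have scale: "q (c *\<^sub>R u) = c * q u" if c: "0 \<le> c" and u: "0 \<le> u" for c u
  proof (cases "c = 0")
    case True
    have "q 0 = 0" using add[of 0 0] by simp
    then show ?thesis using True by simp
  next
    case False
    then have c: "0 < c" using c by simp
    have "q ((1 / c) *\<^sub>R (c *\<^sub>R u)) \<le> (1 / c) * q (c *\<^sub>R u)"
      using c u by (intro scale_le) (simp_all add: scaleR_nonneg_nonneg)
    then have "c * q u \<le> q (c *\<^sub>R u)" using c by (simp add: field_simps)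
    then show ?thesis using scale_le[OF c u] by simp
  qed
  have L: "L (a - b) = q a - q b" if ab: "0 \<le> a" "0 \<le> b" for a b
  proof -
    have "pprt (a - b) + b = a + pprt (- (a - b))"
      using pos_diff[of "a - b"] by (simp add: algebra_simps)
    then have "q (pprt (a - b)) + q b = q a + q (pprt (- (a - b)))"
      using ab by (metis add zero_le_pprt)
    then show ?thesis unfolding L_def by linarith
  qed
  have Lpos: "L u = q u" if "0 \<le> u" for u
    using L[OF that order_refl] add[of 0 0] by simp
  have "bounded_linear L"
  proof (rule bounded_linear_intro)
    fix x y :: 'a
    have "x + y = (pprt x + pprt y) - (pprt (- x) + pprt (- y))"
      by (subst pos_diff[of x], subst pos_diff[of y]) (simp only: add_diff_add)
    then have "L (x + y) = q (pprt x + pprt y) - q (pprt (- x) + pprt (- y))"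
      by (metis L add_nonneg_nonneg zero_le_pprt)
    then show "L (x + y) = L x + L y"
      by (simp add: L_def add)
  next
    fix r :: real and x :: 'a
    show "L (r *\<^sub>R x) = r *\<^sub>R L x"
    proof (cases "0 \<le> r")
      case True
      have "r *\<^sub>R x = r *\<^sub>R pprt x - r *\<^sub>R pprt (- x)"
        by (subst pos_diff[of x]) (simp add: algebra_simps)
      then have "L (r *\<^sub>R x) = q (r *\<^sub>R pprt x) - q (r *\<^sub>R pprt (- x))"
        by (metis L True scaleR_nonneg_nonneg zero_le_pprt)
      then show ?thesis using True by (simp add: L_def scale algebra_simps)
    next
      case False
      then have r: "0 \<le> - r" by simp
      have "r *\<^sub>R x = (- r) *\<^sub>R pprt (- x) - (- r) *\<^sub>R pprt x"
        by (subst pos_diff[of x]) (simp add: algebra_simps)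
      then have "L (r *\<^sub>R x) = q ((- r) *\<^sub>R pprt (- x)) - q ((- r) *\<^sub>R pprt x)"
        by (metis L r scaleR_nonneg_nonneg zero_le_pprt)
      also have "\<dots> = (- r) * q (pprt (- x)) - (- r) * q (pprt x)"
        by (simp only: scale[OF r] zero_le_pprt)
      finally show ?thesis by (simp add: L_def algebra_simps)
    qed
  next
    fix x :: 'a
    have b: "q z \<le> norm D * norm x" if "0 \<le> z" "z \<le> \<bar>x\<bar>" for z
    proof (rule least)
      fix y assume "0 \<le> y" "y \<le> z"
      then show "blinfun_apply D y \<le> norm D * norm x"
        using Dle[of y "\<bar>x\<bar>"] that by simp
    qed (use that in simp)
    have "pprt x \<le> \<bar>x\<bar>" "pprt (- x) \<le> \<bar>x\<bar>"
      by (simp_all add: pprt_def abs_ge_self abs_ge_minus_self)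
    then have "q (pprt x) \<le> norm D * norm x" "q (pprt (- x)) \<le> norm D * norm x"
      by (simp_all add: b)
    then show "norm (L x) \<le> norm x * norm D"
      using q0[of "pprt x"] q0[of "pprt (- x)"] by (simp add: L_def abs_le_iff mult.commute)
  qed
  then have K: "blinfun_apply (Blinfun L) = L" by (rule bounded_linear_Blinfun_apply)
  show ?thesis
  proof (rule that[of "Blinfun L"])
    fix y u :: 'a assume *: "0 \<le> y" "y \<le> u"
    then have "0 \<le> u" by order
    then show "blinfun_apply D y \<le> blinfun_apply (Blinfun L) u"
      using upper[OF *] by (simp add: K Lpos)
  next
    fix u c assume "0 \<le> u" "\<And>y. 0 \<le> y \<Longrightarrow> y \<le> u \<Longrightarrow> blinfun_apply D y \<le> c"
    then show "blinfun_apply (Blinfun L) u \<le> c" by (simp add: K Lpos least)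
  qed
qed


subsection \<open>The dual as a Banach lattice\<close>

text \<open>A type-class instance on \<open>'a \<Rightarrow>\<^sub>L 'b\<close> can restrict \<open>'b\<close> only by a class. The following class
  axiomatises the real field itself: by its last axiom, \<open>of_real\<close> is onto. Its only purpose is to
  give \<open>'a \<Rightarrow>\<^sub>L real\<close> its order.\<close>

class real_line = real_normed_algebra_1 + banach + linordered_idom +
  assumes norm_scaleR_one_eq_abs: "norm x *\<^sub>R 1 = \<bar>x\<bar>"

instance real :: real_line
  by standard simp

lemma of_real_norm_eq_abs: "of_real (norm x) = \<bar>x::'b::real_line\<bar>"
  by (simp add: of_real_def norm_scaleR_one_eq_abs)

lemma of_real_le_real_line [simp]:
  "(of_real a :: 'b::real_line) \<le> of_real b \<longleftrightarrow> a \<le> b"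
proof -
  have pos: "0 \<le> (of_real r :: 'b)" if "0 \<le> r" for r
  proof -
    have "(of_real r :: 'b) = of_real (sqrt r) * of_real (sqrt r)"
      using that by (simp flip: of_real_mult)
    then show ?thesis by simp
  qed
  have mono: "(of_real r :: 'b) \<le> of_real s" if "r \<le> s" for r s
    using pos[of "s - r"] that by simp
  show ?thesis
    using mono[of a b] mono[of b a] by (metis linear of_real_eq_iff order_antisym)
qed

definition real_of :: "'b::real_line \<Rightarrow> real" where
  "real_of x = (THE r. of_real r = x)"

lemma of_real_real_of [simp]: "of_real (real_of (x::'b::real_line)) = x"
proof -
  have "of_real (norm x) = x \<or> of_real (- norm x) = x"
    by (simp add: of_real_norm_eq_abs abs_if)
  then obtain r where r: "of_real r = x" by blast
  show ?thesis unfolding real_of_def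
    by (rule theI[of _ r]) (use r in auto)
qed

lemma real_of_of_real [simp]: "real_of (of_real r :: 'b::real_line) = r"
  by (metis of_real_real_of of_real_eq_iff)

lemma real_of_le_iff [simp]: "real_of x \<le> real_of y \<longleftrightarrow> x \<le> (y::'b::real_line)"
  by (metis of_real_real_of of_real_le_real_line)

lemma abs_real_of [simp]: "\<bar>real_of x\<bar> = norm (x::'b::real_line)"
  by (metis of_real_real_of norm_of_real)

lemma bounded_linear_real_of: "bounded_linear (real_of :: 'b::real_line \<Rightarrow> real)"
proof (rule bounded_linear_intro[where K = 1])
  fix x y :: 'b and r :: real
  show "real_of (x + y) = real_of x + real_of y"
    by (metis of_real_real_of real_of_of_real of_real_add)
  show "real_of (r *\<^sub>R x) = r *\<^sub>R real_of x"
    by (metis of_real_real_of real_of_of_real of_real_mult scaleR_conv_of_real real_scaleR_def)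
qed simp

instantiation blinfun :: (banach_lattice, real_line) banach_lattice
begin

definition less_eq_blinfun :: "('a \<Rightarrow>\<^sub>L 'b) \<Rightarrow> ('a \<Rightarrow>\<^sub>L 'b) \<Rightarrow> bool" where
  "f \<le> g \<longleftrightarrow> (\<forall>x\<ge>0. blinfun_apply f x \<le> blinfun_apply g x)"

definition less_blinfun :: "('a \<Rightarrow>\<^sub>L 'b) \<Rightarrow> ('a \<Rightarrow>\<^sub>L 'b) \<Rightarrow> bool" where
  "(f :: 'a \<Rightarrow>\<^sub>L 'b) < g \<longleftrightarrow> f \<le> g \<and> \<not> g \<le> f"

definition sup_blinfun :: "('a \<Rightarrow>\<^sub>L 'b) \<Rightarrow> ('a \<Rightarrow>\<^sub>L 'b) \<Rightarrow> ('a \<Rightarrow>\<^sub>L 'b)" where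
  "sup (f :: 'a \<Rightarrow>\<^sub>L 'b) g = (THE h. f \<le> h \<and> g \<le> h \<and> (\<forall>k. f \<le> k \<longrightarrow> g \<le> k \<longrightarrow> h \<le> k))"

definition inf_blinfun :: "('a \<Rightarrow>\<^sub>L 'b) \<Rightarrow> ('a \<Rightarrow>\<^sub>L 'b) \<Rightarrow> ('a \<Rightarrow>\<^sub>L 'b)" where
  "inf (f :: 'a \<Rightarrow>\<^sub>L 'b) g = - sup (- f) (- g)"

definition abs_blinfun :: "('a \<Rightarrow>\<^sub>L 'b) \<Rightarrow> ('a \<Rightarrow>\<^sub>L 'b)" where
  "\<bar>f :: 'a \<Rightarrow>\<^sub>L 'b\<bar> = sup f (- f)"

instance
proof -
  have refl: "f \<le> f" for f :: "'a \<Rightarrow>\<^sub>L 'b"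
    by (simp add: less_eq_blinfun_def)
  have trans: "f \<le> h" if "f \<le> g" "g \<le> h" for f g h :: "'a \<Rightarrow>\<^sub>L 'b"
    using that unfolding less_eq_blinfun_def by (meson order_trans)
  have anti: "f = g" if "f \<le> g" "g \<le> f" for f g :: "'a \<Rightarrow>\<^sub>L 'b"
  proof (rule blinfun_eqI)
    fix x
    have *: "blinfun_apply f x = blinfun_apply g x" if "0 \<le> x" for x
      using \<open>f \<le> g\<close> \<open>g \<le> f\<close> that by (auto simp: less_eq_blinfun_def intro: antisym)
    show "blinfun_apply f x = blinfun_apply g x"
      by (subst (1 2) pos_diff[of x]) (simp add: blinfun.diff_right *)
  qed
  have neg_le: "- f \<le> - g \<longleftrightarrow> g \<le> f" for f g :: "'a \<Rightarrow>\<^sub>L 'b"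
    by (simp add: less_eq_blinfun_def blinfun.minus_left)
  have ex: "\<exists>h. f \<le> h \<and> g \<le> h \<and> (\<forall>k. f \<le> k \<longrightarrow> g \<le> k \<longrightarrow> h \<le> k) \<and>
      (\<forall>u c. 0 \<le> u \<longrightarrow> (\<forall>y. 0 \<le> y \<longrightarrow> y \<le> u \<longrightarrow>
          blinfun_apply f y + blinfun_apply g (u - y) \<le> c) \<longrightarrow> blinfun_apply h u \<le> c)"
    for f g :: "'a \<Rightarrow>\<^sub>L 'b"
  proof -
    have "bounded_linear (\<lambda>x. real_of (blinfun_apply (f - g) x))"
      by (intro bounded_linear_compose[OF bounded_linear_real_of] blinfun.bounded_linear_right)
    then have D: "blinfun_apply (Blinfun (\<lambda>x. real_of (blinfun_apply (f - g) x))) x =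
        real_of (blinfun_apply f x - blinfun_apply g x)" for x
      by (simp add: bounded_linear_Blinfun_apply blinfun.diff_left)
    obtain K :: "'a \<Rightarrow>\<^sub>L real" where
      K1: "\<And>y u. 0 \<le> y \<Longrightarrow> y \<le> u \<Longrightarrow>
         real_of (blinfun_apply f y - blinfun_apply g y) \<le> blinfun_apply K u"
      and K2: "\<And>u c. 0 \<le> u \<Longrightarrow> (\<And>y. 0 \<le> y \<Longrightarrow> y \<le> u \<Longrightarrow>
         real_of (blinfun_apply f y - blinfun_apply g y) \<le> c) \<Longrightarrow> blinfun_apply K u \<le> c"
      using positive_part_functional[of "Blinfun (\<lambda>x. real_of (blinfun_apply (f - g) x))"]
      unfolding D by metis
    define h where "h = g + Blinfun (\<lambda>x. of_real (blinfun_apply K x))"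
    have "bounded_linear (\<lambda>x. of_real (blinfun_apply K x) :: 'b)"
      by (intro bounded_linear_compose[OF bounded_linear_of_real] blinfun.bounded_linear_right)
    then have h: "blinfun_apply h x = blinfun_apply g x + of_real (blinfun_apply K x)" for x
      by (simp add: h_def blinfun.add_left bounded_linear_Blinfun_apply)
    have K1': "blinfun_apply f y - blinfun_apply g y \<le> of_real (blinfun_apply K u)"
      if "0 \<le> y" "y \<le> u" for y u
      using K1[OF that] by (metis of_real_real_of of_real_le_real_line)
    have K2': "of_real (blinfun_apply K u) \<le> c"
      if "0 \<le> u" "\<And>y. 0 \<le> y \<Longrightarrow> y \<le> u \<Longrightarrow> blinfun_apply f y - blinfun_apply g y \<le> c"
      for u and c :: 'b
    proof -
      have "blinfun_apply K u \<le> real_of c" using that by (intro K2) simp_all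
      then show ?thesis by (metis of_real_real_of of_real_le_real_line)
    qed
    have "f \<le> h" unfolding less_eq_blinfun_def
      using K1'[OF _ order_refl] by (simp add: h algebra_simps)
    moreover have "g \<le> h" unfolding less_eq_blinfun_def
      using K1'[OF order_refl] by (simp add: h blinfun.zero_right)
    moreover have bound: "blinfun_apply h u \<le> c"
      if u: "0 \<le> u" and y: "\<And>y. 0 \<le> y \<Longrightarrow> y \<le> u \<Longrightarrow>
        blinfun_apply f y + blinfun_apply g (u - y) \<le> c" for u c
    proof -
      have "of_real (blinfun_apply K u) \<le> c - blinfun_apply g u"
        using y by (intro K2'[OF u]) (simp add: blinfun.diff_right algebra_simps)
      then show ?thesis by (simp add: h algebra_simps)
    qed
    moreover have "h \<le> k" if k: "f \<le> k" "g \<le> k" for k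
      unfolding less_eq_blinfun_def
    proof (intro allI impI)
      fix u :: 'a assume u: "0 \<le> u"
      show "blinfun_apply h u \<le> blinfun_apply k u"
      proof (rule bound[OF u])
        fix y assume "0 \<le> y" "y \<le> u"
        then have "blinfun_apply f y \<le> blinfun_apply k y"
          "blinfun_apply g (u - y) \<le> blinfun_apply k (u - y)"
          using k by (auto simp: less_eq_blinfun_def)
        then have "blinfun_apply f y + blinfun_apply g (u - y)
            \<le> blinfun_apply k y + blinfun_apply k (u - y)" by (rule add_mono)
        then show "blinfun_apply f y + blinfun_apply g (u - y) \<le> blinfun_apply k u"
          by (simp add: blinfun.diff_right)
      qed
    qed
    ultimately show ?thesis by blast
  qed
  have sup_eq: "sup f g = h"
    if "f \<le> h" "g \<le> h" "\<And>k. f \<le> k \<Longrightarrow> g \<le> k \<Longrightarrow> h \<le> k" for f g h :: "'a \<Rightarrow>\<^sub>L 'b"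
    unfolding sup_blinfun_def using that by (intro the_equality) (auto intro: anti)
  have sup1: "f \<le> sup f g" and sup2: "g \<le> sup f g"
    and sup3: "f \<le> k \<Longrightarrow> g \<le> k \<Longrightarrow> sup f g \<le> k"
    and sup4: "0 \<le> u \<Longrightarrow> (\<And>y. 0 \<le> y \<Longrightarrow> y \<le> u \<Longrightarrow>
        blinfun_apply f y + blinfun_apply g (u - y) \<le> c) \<Longrightarrow> blinfun_apply (sup f g) u \<le> c"
    for f g k :: "'a \<Rightarrow>\<^sub>L 'b" and u c
    using ex[of f g] sup_eq[of f _ g] by metis+
  have norm_mono: "norm f \<le> norm g" if fg: "\<bar>f\<bar> \<le> \<bar>g\<bar>" for f g :: "'a \<Rightarrow>\<^sub>L 'b"
  proof (rule norm_blinfun_bound)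
    fix x :: 'a
    let ?u = "\<bar>x\<bar>"
    have le: "blinfun_apply f z \<le> blinfun_apply \<bar>f\<bar> z" "- blinfun_apply f z \<le> blinfun_apply \<bar>f\<bar> z"
      if "0 \<le> z" for z
      using sup1[of f "- f"] sup2[of "- f" f] that
      by (auto simp: abs_blinfun_def less_eq_blinfun_def blinfun.minus_left)
    have fx: "blinfun_apply f x = blinfun_apply f (pprt x) - blinfun_apply f (pprt (- x))"
      by (subst pos_diff[of x]) (simp add: blinfun.diff_right)
    have "?u = pprt x + pprt (- x)"
      by (simp add: abs_prts pprt_neg)
    then have fu: "blinfun_apply \<bar>f\<bar> ?u = blinfun_apply \<bar>f\<bar> (pprt x) + blinfun_apply \<bar>f\<bar> (pprt (- x))"
      by (simp add: blinfun.add_right)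
    have "\<bar>blinfun_apply f x\<bar> \<le> blinfun_apply \<bar>f\<bar> ?u"
      using le[of "pprt x"] le[of "pprt (- x)"] unfolding fx fu abs_le_iff
      by (simp add: algebra_simps)
    also have "\<dots> \<le> blinfun_apply \<bar>g\<bar> ?u"
      using fg by (simp add: less_eq_blinfun_def)
    also have "\<dots> \<le> of_real (norm g * norm x)"
      unfolding abs_blinfun_def
    proof (rule sup4)
      fix y :: 'a assume y: "0 \<le> y" "y \<le> ?u"
      have "- (y + y - ?u) \<le> ?u"
        using add_nonneg_nonneg[OF y(1) y(1)] by (simp add: minus_diff_eq diff_le_eq)
      moreover have "y + y - ?u \<le> ?u"
        using add_mono[OF y(2) y(2)] by (simp only: diff_le_eq)
      ultimately have "\<bar>y + y - ?u\<bar> \<le> ?u" by (intro abs_leI)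
      then have n: "norm (y + y - ?u) \<le> norm x" using norm_mono_abs[of "y + y - ?u" x] by simp
      have "blinfun_apply g y + blinfun_apply (- g) (?u - y) = blinfun_apply g (y + y - ?u)"
        by (simp add: blinfun.minus_left blinfun.diff_right blinfun.add_right)
      also have "\<dots> \<le> of_real (norm (blinfun_apply g (y + y - ?u)))"
        by (simp add: of_real_norm_eq_abs)
      also have "\<dots> \<le> of_real (norm g * norm x)"
        using norm_blinfun[of g "y + y - ?u"] mult_left_mono[OF n norm_ge_zero[of g]]
        by (simp only: of_real_le_real_line)
      finally show "blinfun_apply g y + blinfun_apply (- g) (?u - y) \<le> of_real (norm g * norm x)" .
    qed simp
    finally have "(of_real (norm (blinfun_apply f x)) :: 'b) \<le> of_real (norm g * norm x)"
      by (simp add: of_real_norm_eq_abs)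
    then show "norm (blinfun_apply f x) \<le> norm g * norm x"
      by (simp only: of_real_le_real_line)
  qed simp
  show "OFCLASS('a \<Rightarrow>\<^sub>L 'b, banach_lattice_class)"
  proof
    fix f g h :: "'a \<Rightarrow>\<^sub>L 'b" and r s :: real
    show "f < g \<longleftrightarrow> f \<le> g \<and> \<not> g \<le> f" by (rule less_blinfun_def)
    show "f \<le> f" by (rule refl)
    show "f \<le> g \<Longrightarrow> g \<le> h \<Longrightarrow> f \<le> h" by (rule trans)
    show "f \<le> g \<Longrightarrow> g \<le> f \<Longrightarrow> f = g" by (rule anti)
    show "f \<le> g \<Longrightarrow> h + f \<le> h + g" by (simp add: less_eq_blinfun_def blinfun.add_left)
    have sc: "(a *\<^sub>R v :: 'b) \<le> b *\<^sub>R w" if "of_real a * v \<le> of_real b * w" for a b v w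
      using that by (simp add: scaleR_conv_of_real)
    have nn: "0 \<le> (of_real a :: 'b) \<longleftrightarrow> 0 \<le> a" for a
      using of_real_le_real_line[of 0 a, where 'b = 'b] by simp
    show "f \<le> g \<Longrightarrow> 0 \<le> r \<Longrightarrow> r *\<^sub>R f \<le> r *\<^sub>R g"
      by (auto simp: less_eq_blinfun_def blinfun.scaleR_left nn intro!: sc mult_left_mono)
    show "r \<le> s \<Longrightarrow> 0 \<le> f \<Longrightarrow> r *\<^sub>R f \<le> s *\<^sub>R f"
      by (auto simp: less_eq_blinfun_def blinfun.scaleR_left intro!: sc mult_right_mono)
    show "f \<le> sup f g" "g \<le> sup f g" by (rule sup1 sup2)+
    show "g \<le> f \<Longrightarrow> h \<le> f \<Longrightarrow> sup g h \<le> f" by (rule sup3)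
    show "inf f g \<le> f" using sup1[of "- f" "- g"] by (metis inf_blinfun_def neg_le minus_minus)
    show "inf f g \<le> g" using sup2[of "- g" "- f"] by (metis inf_blinfun_def neg_le minus_minus)
    show "f \<le> g \<Longrightarrow> f \<le> h \<Longrightarrow> f \<le> inf g h"
      using sup3[of "- g" "- f" "- h"] by (metis inf_blinfun_def neg_le minus_minus)
    show "\<bar>f\<bar> = sup f (- f)" by (rule abs_blinfun_def)
    show "\<bar>f\<bar> \<le> \<bar>g\<bar> \<Longrightarrow> norm f \<le> norm g" by (rule norm_mono)
  qed
qed

end


section \<open>The disjoint Grothendieck property\<close>

definition disjoint_seq :: "(nat \<Rightarrow> 'a::banach_lattice) \<Rightarrow> bool" where
  "disjoint_seq x \<longleftrightarrow> (\<forall>j k. j \<noteq> k \<longrightarrow> inf \<bar>x j\<bar> \<bar>x k\<bar> = 0)"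

definition weakly_null :: "(nat \<Rightarrow> 'a::real_normed_vector) \<Rightarrow> bool" where
  "weakly_null x \<longleftrightarrow> (\<forall>\<phi> :: 'a \<Rightarrow>\<^sub>L real. (\<lambda>n. blinfun_apply \<phi> (x n)) \<longlonglongrightarrow> 0)"

definition disjoint_Grothendieck :: "'a::banach_lattice itself \<Rightarrow> bool" where
  "disjoint_Grothendieck _ \<longleftrightarrow>
     (\<forall>x :: nat \<Rightarrow> ('a \<Rightarrow>\<^sub>L real). bounded (range x) \<and> disjoint_seq x \<longrightarrow> weakly_null x)"


section \<open>Banach sequence lattices\<close>

instantiation "fun" :: (type, real_vector) real_vector
begin

definition scaleR_fun :: "real \<Rightarrow> ('a \<Rightarrow> 'b) \<Rightarrow> ('a \<Rightarrow> 'b)" where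
  "scaleR_fun c f = (\<lambda>x. c *\<^sub>R f x)"

instance
  by standard (simp_all add: scaleR_fun_def fun_eq_iff algebra_simps)

end

text \<open>Suprema and infima are taken inside \<open>X\<close>, since a space that is a lattice in the pointwise
  ordering need not be closed under pointwise suprema.\<close>

definition sup_in :: "'v::order set \<Rightarrow> 'v \<Rightarrow> 'v \<Rightarrow> 'v \<Rightarrow> bool" where
  "sup_in X x y s \<longleftrightarrow> s \<in> X \<and> x \<le> s \<and> y \<le> s \<and> (\<forall>u\<in>X. x \<le> u \<longrightarrow> y \<le> u \<longrightarrow> s \<le> u)"

definition inf_in :: "'v::order set \<Rightarrow> 'v \<Rightarrow> 'v \<Rightarrow> 'v \<Rightarrow> bool" where
  "inf_in X x y s \<longleftrightarrow> s \<in> X \<and> s \<le> x \<and> s \<le> y \<and> (\<forall>u\<in>X. u \<le> x \<longrightarrow> u \<le> y \<longrightarrow> u \<le> s)"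

text \<open>\<open>X\<close> is the space and \<open>N\<close> its norm; the values of \<open>N\<close> outside \<open>X\<close> are irrelevant. The order
  on \<open>nat \<Rightarrow> 'g\<close> is the pointwise one.\<close>

definition banach_sequence_lattice ::
    "(nat \<Rightarrow> 'g::banach_lattice) set \<Rightarrow> ((nat \<Rightarrow> 'g) \<Rightarrow> real) \<Rightarrow> bool" where
  "banach_sequence_lattice X N \<longleftrightarrow>
     subspace X \<and>
     (\<forall>x\<in>X. 0 \<le> N x \<and> (N x = 0 \<longleftrightarrow> x = 0)) \<and>
     (\<forall>c. \<forall>x\<in>X. N (c *\<^sub>R x) = \<bar>c\<bar> * N x) \<and>
     (\<forall>x\<in>X. \<forall>y\<in>X. N (x + y) \<le> N x + N y) \<and>
     (\<forall>u. (\<forall>n. u n \<in> X) \<and> (\<forall>e>0. \<exists>M. \<forall>m\<ge>M. \<forall>n\<ge>M. N (u m - u n) < e)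
        \<longrightarrow> (\<exists>x\<in>X. (\<lambda>n. N (u n - x)) \<longlonglongrightarrow> 0)) \<and>
     (\<forall>x\<in>X. \<forall>y\<in>X. (\<exists>s. sup_in X x y s) \<and> (\<exists>s. inf_in X x y s)) \<and>
     (\<forall>x\<in>X. \<forall>y\<in>X. \<forall>a b. sup_in X x (- x) a \<and> sup_in X y (- y) b \<and> a \<le> b \<longrightarrow> N x \<le> N y)"

definition closed_sublattice ::
    "(nat \<Rightarrow> 'g::banach_lattice) set \<Rightarrow> ((nat \<Rightarrow> 'g) \<Rightarrow> real) \<Rightarrow> (nat \<Rightarrow> 'g) set \<Rightarrow> bool" where
  "closed_sublattice X N Y \<longleftrightarrow>
     Y \<subseteq> X \<and> subspace Y \<and>
     (\<forall>x\<in>Y. \<forall>y\<in>Y. \<forall>s. sup_in X x y s \<or> inf_in X x y s \<longrightarrow> s \<in> Y) \<and>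
     (\<forall>u. \<forall>x\<in>X. (\<forall>n. u n \<in> Y) \<and> (\<lambda>n. N (u n - x)) \<longlonglongrightarrow> 0 \<longrightarrow> x \<in> Y)"

definition infinite_dimensional :: "'v::real_vector set \<Rightarrow> bool" where
  "infinite_dimensional Y \<longleftrightarrow> \<not> (\<exists>S. finite S \<and> Y \<subseteq> span S)"

definition almost_positive_pointwise_latticeable ::
    "(nat \<Rightarrow> 'g::banach_lattice) set \<Rightarrow> ((nat \<Rightarrow> 'g) \<Rightarrow> real) \<Rightarrow> (nat \<Rightarrow> 'g) set \<Rightarrow> bool" where
  "almost_positive_pointwise_latticeable X N B \<longleftrightarrow>
     banach_sequence_lattice X N \<and> B \<subseteq> X \<and> (\<exists>x\<in>B. 0 \<le> x) \<and>
     (\<forall>x\<in>B. 0 \<le> x \<longrightarrow>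
        (\<exists>Y. closed_sublattice X N Y \<and> infinite_dimensional Y \<and> Y \<subseteq> B \<union> {0} \<and>
             (\<exists>r. strict_mono r \<and> x \<circ> r \<in> Y)))"

definition l_infty :: "(nat \<Rightarrow> 'g::real_normed_vector) set" where
  "l_infty = {x. bounded (range x)}"

definition l_infty_norm :: "(nat \<Rightarrow> 'g::real_normed_vector) \<Rightarrow> real" where
  "l_infty_norm x = (SUP j. norm (x j))"

end

theory Submission
  imports Defs
begin

text \<open>
  The lattices are built in an arbitrary Banach lattice \<open>G\<close>; the theorem is the case \<open>G = E\<^sup>*\<close>.

  Let \<open>x\<close> be a positive bounded disjoint sequence in \<open>G\<close> that is not weakly null. Some functional
  \<open>\<phi>\<close> stays away from \<open>0\<close> along a subsequence \<open>z = x \<circ> r\<close>. Split the index set of \<open>z\<close> into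
  infinitely many infinite blocks, and let \<open>Y\<close> consist of all bounded sequences obtained from
  \<open>z\<close> by multiplying it on each block by a constant (\<open>block_multiples\<close>). Then
  \<^item> \<open>Y\<close> contains \<open>z\<close> itself, with all constants equal to \<open>1\<close>;
  \<^item> \<open>Y\<close> is a sublattice, since suprema of multiples of one positive vector are formed on the
    scalars, and it is closed, since the scalars converge when the multiples of a nonzero vector do
    (\<open>closed_sublattice_block_multiples\<close>);
  \<^item> \<open>Y\<close> is infinite dimensional, since the restrictions of \<open>z\<close> to different blocks are
    independent (\<open>infinite_dimensional_block_multiples\<close>);
  \<^item> elements of \<open>Y\<close> inherit disjointness from \<open>z\<close>, and a nonzero element has a nonzero
    constant on some block; this block is infinite, so \<open>\<phi>\<close> stays away from \<open>0\<close> along it, and the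
    element is not weakly null (\<open>not_weakly_null_block_multiples\<close>).

  The set in question contains a positive sequence at all because a bounded disjoint sequence
  \<open>x\<close> that is not weakly null can be replaced by \<open>\<lambda>n. \<bar>x n\<bar>\<close>: if \<open>\<phi>\<close> detects \<open>x\<close>, the functional
  \<open>\<bar>\<phi>\<bar>\<close> detects \<open>\<lambda>n. \<bar>x n\<bar>\<close> (\<open>weakly_null_if_abs\<close>).
\<close>

section \<open>Multiples in Banach lattices\<close>

lemma abs_scaleR_le:
  fixes v :: "'g::banach_lattice"
  shows "\<bar>c *\<^sub>R v\<bar> \<le> \<bar>c\<bar> *\<^sub>R \<bar>v\<bar>"
proof (cases "0 \<le> c")
  case True
  have "c *\<^sub>R v \<le> c *\<^sub>R \<bar>v\<bar>" "c *\<^sub>R (- v) \<le> c *\<^sub>R \<bar>v\<bar>"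
    using True by (intro scaleR_left_mono abs_ge_self abs_ge_minus_self; simp)+
  then show ?thesis using True by (intro abs_leI) simp_all
next
  case False
  have "(- c) *\<^sub>R v \<le> (- c) *\<^sub>R \<bar>v\<bar>" "(- c) *\<^sub>R (- v) \<le> (- c) *\<^sub>R \<bar>v\<bar>"
    using False by (intro scaleR_left_mono abs_ge_self abs_ge_minus_self; simp)+
  then show ?thesis using False by (intro abs_leI) simp_all
qed

lemma disjoint_scaleR:
  fixes u v :: "'g::banach_lattice"
  assumes "inf \<bar>u\<bar> \<bar>v\<bar> = 0"
  shows "inf \<bar>c *\<^sub>R u\<bar> \<bar>d *\<^sub>R v\<bar> = 0"
proof -
  \<comment> \<open>A common factor for both vectors; the summand \<open>1\<close> makes it invertible.\<close>
  define e where "e = \<bar>c\<bar> + \<bar>d\<bar> + 1"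
  let ?w = "inf \<bar>c *\<^sub>R u\<bar> \<bar>d *\<^sub>R v\<bar>"
  have e: "0 < e" "\<bar>c\<bar> \<le> e" "\<bar>d\<bar> \<le> e" by (simp_all add: e_def)
  have "\<bar>c *\<^sub>R u\<bar> \<le> e *\<^sub>R \<bar>u\<bar>" "\<bar>d *\<^sub>R v\<bar> \<le> e *\<^sub>R \<bar>v\<bar>"
    using abs_scaleR_le e(2,3) scaleR_right_mono[OF _ abs_ge_zero] by (meson order_trans)+
  then have "?w \<le> e *\<^sub>R \<bar>u\<bar>" "?w \<le> e *\<^sub>R \<bar>v\<bar>"
    by (meson le_infI1 le_infI2)+
  then have "(1 / e) *\<^sub>R ?w \<le> (1 / e) *\<^sub>R e *\<^sub>R \<bar>u\<bar>" "(1 / e) *\<^sub>R ?w \<le> (1 / e) *\<^sub>R e *\<^sub>R \<bar>v\<bar>"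
    using e by (intro scaleR_left_mono; simp)+
  then have "(1 / e) *\<^sub>R ?w \<le> inf \<bar>u\<bar> \<bar>v\<bar>" using e by simp
  then have "e *\<^sub>R (1 / e) *\<^sub>R ?w \<le> e *\<^sub>R 0"
    using e assms by (intro scaleR_left_mono) simp_all
  then have "?w \<le> 0" using e by simp
  then show ?thesis by (intro antisym) simp_all
qed

lemma sup_scaleR_max:
  fixes v :: "'g::banach_lattice"
  assumes "0 \<le> v"
  shows "sup (c *\<^sub>R v) (d *\<^sub>R v) = max c d *\<^sub>R v"
  using scaleR_right_mono[of c d v] scaleR_right_mono[of d c v] assms
  by (cases "c \<le> d") (simp_all add: sup_absorb1 sup_absorb2)

lemma inf_scaleR_min:
  fixes v :: "'g::banach_lattice"
  assumes "0 \<le> v"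
  shows "inf (c *\<^sub>R v) (d *\<^sub>R v) = min c d *\<^sub>R v"
  using scaleR_right_mono[of c d v] scaleR_right_mono[of d c v] assms
  by (cases "c \<le> d") (simp_all add: inf_absorb1 inf_absorb2)

lemma Cauchy_scaleR_vector:
  fixes v :: "'g::real_normed_vector"
  assumes "Cauchy (\<lambda>k. c k *\<^sub>R v)" "v \<noteq> 0"
  shows "Cauchy c"
proof (rule metric_CauchyI)
  fix e :: real assume "0 < e"
  then have "0 < e * norm v" using assms(2) by simp
  then obtain M where M: "\<And>m n. M \<le> m \<Longrightarrow> M \<le> n \<Longrightarrow> dist (c m *\<^sub>R v) (c n *\<^sub>R v) < e * norm v"
    using metric_CauchyD[OF assms(1)] by blast
  have "dist (c m *\<^sub>R v) (c n *\<^sub>R v) = dist (c m) (c n) * norm v" for m n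
    by (simp add: dist_norm flip: scaleR_left_diff_distrib)
  then show "\<exists>M. \<forall>m\<ge>M. \<forall>n\<ge>M. dist (c m) (c n) < e"
    using M assms(2) by (intro exI[of _ M]) auto
qed


section \<open>The Banach lattice of bounded sequences\<close>

text \<open>As \<open>nat\<close> is a discrete space, the bounded sequences are the bounded continuous
  functions on \<open>nat\<close>; this identification provides the norm axioms and completeness.\<close>

lemma l_infty_bcontfun: "l_infty = (bcontfun :: (nat \<Rightarrow> 'g::real_normed_vector) set)"
  by (auto simp: l_infty_def bcontfun_def intro: continuous_on_discrete)

lemma l_infty_norm_bcontfun: "l_infty_norm (apply_bcontfun f) = norm f"
  by (simp add: l_infty_norm_def norm_bcontfun_def dist_bcontfun_def)

lemma l_inftyE:
  assumes "x \<in> l_infty"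
  obtains f where "x = apply_bcontfun f"
  using assms by (metis l_infty_bcontfun Bcontfun_inverse)

lemma apply_bcontfun_l_infty [simp]: "apply_bcontfun f \<in> l_infty"
  by (simp add: l_infty_bcontfun apply_bcontfun)

lemma bcontfun_fun_simps:
  fixes f g :: "nat \<Rightarrow>\<^sub>C 'g::real_normed_vector"
  shows "apply_bcontfun f + apply_bcontfun g = apply_bcontfun (f + g)"
    and "apply_bcontfun f - apply_bcontfun g = apply_bcontfun (f - g)"
    and "c *\<^sub>R apply_bcontfun f = apply_bcontfun (c *\<^sub>R f)"
    and "(0 :: nat \<Rightarrow> 'g) = apply_bcontfun 0"
  by (auto simp: fun_eq_iff plus_bcontfun.rep_eq minus_bcontfun.rep_eq scaleR_bcontfun.rep_eq
      zero_bcontfun.rep_eq scaleR_fun_def)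

text \<open>Arguments about the norm need operations on sequences to be rewritten into operations on
  bounded continuous functions, where norm laws apply; the default orientation would undo that.\<close>

declare plus_bcontfun.rep_eq [simp del] minus_bcontfun.rep_eq [simp del]
  scaleR_bcontfun.rep_eq [simp del] zero_bcontfun.rep_eq [simp del]

lemma norm_le_l_infty_norm:
  assumes "x \<in> l_infty"
  shows "norm (x n) \<le> l_infty_norm x"
  using assms by (metis l_inftyE l_infty_norm_bcontfun norm_bounded)

lemma subspace_l_infty: "subspace (l_infty :: (nat \<Rightarrow> 'g::real_normed_vector) set)"
  by (rule subspaceI) (auto elim!: l_inftyE simp: bcontfun_fun_simps)

text \<open>The lattice operations of \<open>\<ell>\<^sub>\<infinity>\<close> are the pointwise ones, because pointwise suprema of
  bounded sequences are bounded.\<close>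

lemma sup_l_infty:
  fixes x y :: "nat \<Rightarrow> 'g::banach_lattice"
  assumes "x \<in> l_infty" "y \<in> l_infty"
  shows "sup x y \<in> l_infty"
proof -
  obtain a b where ab: "\<And>n. norm (x n) \<le> a" "\<And>n. norm (y n) \<le> b"
    using assms by (auto simp: l_infty_def bounded_iff)
  have "norm (sup (x n) (y n)) \<le> a + b" for n
  proof -
    have 1: "x n \<le> \<bar>x n\<bar> + \<bar>y n\<bar>" "y n \<le> \<bar>x n\<bar> + \<bar>y n\<bar>"
      "- x n \<le> \<bar>x n\<bar> + \<bar>y n\<bar>"
      by (simp_all add: abs_ge_self abs_ge_minus_self add_increasing add_increasing2)
    have "- sup (x n) (y n) \<le> - x n" by (simp only: neg_le_iff_le sup_ge1)
    from order_trans[OF this 1(3)] have "\<bar>sup (x n) (y n)\<bar> \<le> \<bar>x n\<bar> + \<bar>y n\<bar>"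
      by (intro abs_leI sup_least 1)
    then have "norm (sup (x n) (y n)) \<le> norm (\<bar>x n\<bar> + \<bar>y n\<bar>)"
      by (metis norm_mono_abs abs_of_nonneg add_nonneg_nonneg abs_ge_zero)
    also have "\<dots> \<le> norm (x n) + norm (y n)"
      by (metis norm_triangle_ineq banach_lattice_norm_abs)
    also have "\<dots> \<le> a + b" using ab by (intro add_mono)
    finally show ?thesis .
  qed
  then show ?thesis by (auto simp: l_infty_def bounded_iff)
qed

lemma inf_l_infty:
  fixes x y :: "nat \<Rightarrow> 'g::banach_lattice"
  assumes "x \<in> l_infty" "y \<in> l_infty"
  shows "inf x y \<in> l_infty"
proof -
  have "inf x y = - sup (- x) (- y)" by (simp add: fun_eq_iff)
  then show ?thesis
    using assms by (simp add: sup_l_infty subspace_neg[OF subspace_l_infty])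
qed

lemma sup_in_l_infty_iff:
  fixes x y :: "nat \<Rightarrow> 'g::banach_lattice"
  assumes "x \<in> l_infty" "y \<in> l_infty"
  shows "sup_in l_infty x y s \<longleftrightarrow> s = sup x y"
  using sup_l_infty[OF assms] unfolding sup_in_def
  by (metis antisym sup_ge1 sup_ge2 sup_least)

lemma inf_in_l_infty_iff:
  fixes x y :: "nat \<Rightarrow> 'g::banach_lattice"
  assumes "x \<in> l_infty" "y \<in> l_infty"
  shows "inf_in l_infty x y s \<longleftrightarrow> s = inf x y"
  using inf_l_infty[OF assms] unfolding inf_in_def
  by (metis antisym inf_le1 inf_le2 inf_greatest)

lemma l_infty_norm_mono_abs:
  fixes x y :: "nat \<Rightarrow> 'g::banach_lattice"
  assumes "y \<in> l_infty" "sup x (- x) \<le> sup y (- y)"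
  shows "l_infty_norm x \<le> l_infty_norm y"
  unfolding l_infty_norm_def[of x]
proof (rule cSUP_least)
  fix n
  have "\<bar>x n\<bar> \<le> \<bar>y n\<bar>" using assms(2) by (simp add: le_fun_def abs_lattice)
  then show "norm (x n) \<le> l_infty_norm y"
    using norm_mono_abs norm_le_l_infty_norm[OF assms(1), of n] order_trans by blast
qed simp

lemma l_infty_complete:
  fixes u :: "nat \<Rightarrow> nat \<Rightarrow> 'g::banach"
  assumes "\<And>n. u n \<in> l_infty"
    and "\<And>e. 0 < e \<Longrightarrow> \<exists>M. \<forall>m\<ge>M. \<forall>n\<ge>M. l_infty_norm (u m - u n) < e"
  shows "\<exists>x\<in>l_infty. (\<lambda>n. l_infty_norm (u n - x)) \<longlonglongrightarrow> 0"
proof -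
  have "\<exists>f. u n = apply_bcontfun f" for n
    using l_inftyE[OF assms(1)[of n]] by blast
  then obtain f where f: "\<And>n. u n = apply_bcontfun (f n)" by metis
  have "Cauchy f"
    using assms(2)
    by (intro metric_CauchyI) (simp add: f bcontfun_fun_simps(2) l_infty_norm_bcontfun dist_norm)
  then have "uniformly_Cauchy_on UNIV (\<lambda>n. apply_bcontfun (f n))"
    unfolding uniformly_Cauchy_on_def Cauchy_def by (metis dist_fun_lt_imp_dist_val_lt)
  then obtain h where "uniform_limit UNIV (\<lambda>n. apply_bcontfun (f n)) h sequentially"
    using Cauchy_uniformly_convergent uniformly_convergent_on_def by blast
  then obtain g where "f \<longlonglongrightarrow> g"
    using uniform_limit_bcontfunE[OF _ sequentially_bot] by metis
  then have "(\<lambda>n. l_infty_norm (u n - apply_bcontfun g)) \<longlonglongrightarrow> 0"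
    by (simp add: f bcontfun_fun_simps(2) l_infty_norm_bcontfun tendsto_norm_zero LIM_zero)
  then show ?thesis by (intro bexI[of _ "apply_bcontfun g"]) simp_all
qed

lemma banach_sequence_lattice_l_infty:
  "banach_sequence_lattice (l_infty :: (nat \<Rightarrow> 'g::banach_lattice) set) l_infty_norm"
  unfolding banach_sequence_lattice_def
proof (intro conjI)
  show "\<forall>x\<in>l_infty. 0 \<le> l_infty_norm x \<and> (l_infty_norm x = 0 \<longleftrightarrow> x = (0 :: nat \<Rightarrow> 'g))"
    by (auto elim!: l_inftyE simp: bcontfun_fun_simps l_infty_norm_bcontfun apply_bcontfun_inject)
  show "\<forall>c. \<forall>x\<in>l_infty. l_infty_norm (c *\<^sub>R x :: nat \<Rightarrow> 'g) = \<bar>c\<bar> * l_infty_norm x"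
    by (auto elim!: l_inftyE simp: bcontfun_fun_simps l_infty_norm_bcontfun)
  show "\<forall>x\<in>l_infty. \<forall>y\<in>l_infty.
      l_infty_norm (x + y :: nat \<Rightarrow> 'g) \<le> l_infty_norm x + l_infty_norm y"
    by (auto elim!: l_inftyE simp: bcontfun_fun_simps l_infty_norm_bcontfun norm_triangle_ineq)
  show "\<forall>x\<in>l_infty. \<forall>y\<in>l_infty. (\<exists>s :: nat \<Rightarrow> 'g. sup_in l_infty x y s) \<and>
      (\<exists>s. inf_in l_infty x y s)"
    by (simp add: sup_in_l_infty_iff inf_in_l_infty_iff)
  show "\<forall>x\<in>l_infty. \<forall>y\<in>l_infty. \<forall>a b :: nat \<Rightarrow> 'g. sup_in l_infty x (- x) a \<and>
      sup_in l_infty y (- y) b \<and> a \<le> b \<longrightarrow> l_infty_norm x \<le> l_infty_norm y"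
    by (simp add: sup_in_l_infty_iff subspace_neg[OF subspace_l_infty] l_infty_norm_mono_abs)
qed (use l_infty_complete subspace_l_infty in blast)+


section \<open>Blockwise multiples of a sequence\<close>

text \<open>The fibres of \<open>\<beta>\<close> are the blocks. Boundedness is imposed on the product and not on the
  coefficients \<open>a\<close>, so that lattice operations and limits can be computed on the coefficients
  with no estimates for them.\<close>

definition block_multiples ::
    "(nat \<Rightarrow> 'i) \<Rightarrow> (nat \<Rightarrow> 'g::real_normed_vector) \<Rightarrow> (nat \<Rightarrow> 'g) set" where
  "block_multiples \<beta> z = {y \<in> l_infty. \<exists>a. \<forall>n. y n = a (\<beta> n) *\<^sub>R z n}"

lemma block_multiples_self: "z \<in> l_infty \<Longrightarrow> z \<in> block_multiples \<beta> z"
  unfolding block_multiples_def by (auto intro!: exI[of _ "\<lambda>_. 1"])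

lemma subspace_block_multiples: "subspace (block_multiples \<beta> z)"
proof (rule subspaceI)
  show "0 \<in> block_multiples \<beta> z"
    using subspace_0[OF subspace_l_infty]
    by (auto simp: block_multiples_def intro!: exI[of _ "\<lambda>_. 0"])
  show "x + y \<in> block_multiples \<beta> z"
    if xy: "x \<in> block_multiples \<beta> z" "y \<in> block_multiples \<beta> z" for x y
  proof -
    obtain a b where ab: "\<And>n. x n = a (\<beta> n) *\<^sub>R z n" "\<And>n. y n = b (\<beta> n) *\<^sub>R z n"
      using xy by (auto simp: block_multiples_def)
    have "x + y \<in> l_infty"
      using xy by (simp add: block_multiples_def subspace_add[OF subspace_l_infty])
    then show ?thesis
      by (auto simp: block_multiples_def ab scaleR_left_distrib
          intro!: exI[of _ "\<lambda>i. a i + b i"])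
  qed
  show "c *\<^sub>R x \<in> block_multiples \<beta> z" if x: "x \<in> block_multiples \<beta> z" for c x
  proof -
    obtain a where a: "\<And>n. x n = a (\<beta> n) *\<^sub>R z n"
      using x by (auto simp: block_multiples_def)
    have "c *\<^sub>R x \<in> l_infty"
      using x by (simp add: block_multiples_def subspace_scale[OF subspace_l_infty])
    then show ?thesis
      by (auto simp: block_multiples_def a scaleR_fun_def intro!: exI[of _ "\<lambda>i. c * a i"])
  qed
qed

lemma block_multiples_lattice:
  fixes z :: "nat \<Rightarrow> 'g::banach_lattice"
  assumes "0 \<le> z" "x \<in> block_multiples \<beta> z" "y \<in> block_multiples \<beta> z"
  shows "sup x y \<in> block_multiples \<beta> z" "inf x y \<in> block_multiples \<beta> z"
proof -
  obtain a b where ab: "\<And>n. x n = a (\<beta> n) *\<^sub>R z n" "\<And>n. y n = b (\<beta> n) *\<^sub>R z n"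
    using assms by (auto simp: block_multiples_def)
  have z: "0 \<le> z n" for n using assms(1) by (simp add: le_fun_def)
  show "sup x y \<in> block_multiples \<beta> z"
    using assms sup_l_infty[of x y]
    by (auto simp: block_multiples_def ab sup_scaleR_max[OF z]
        intro!: exI[of _ "\<lambda>i. max (a i) (b i)"])
  show "inf x y \<in> block_multiples \<beta> z"
    using assms inf_l_infty[of x y]
    by (auto simp: block_multiples_def ab inf_scaleR_min[OF z]
        intro!: exI[of _ "\<lambda>i. min (a i) (b i)"])
qed

text \<open>Even a pointwise limit of blockwise multiples is one: the coefficients of a block converge,
  as can be seen at any one entry of that block.\<close>

lemma block_multiples_closed:
  fixes z :: "nat \<Rightarrow> 'g::real_normed_vector"
  assumes z: "\<And>n. z n \<noteq> 0"
    and u: "\<And>k. u k \<in> block_multiples \<beta> z"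
    and y: "y \<in> l_infty" "\<And>n. (\<lambda>k. u k n) \<longlonglongrightarrow> y n"
  shows "y \<in> block_multiples \<beta> z"
proof -
  obtain a where a: "\<And>k n. u k n = a k (\<beta> n) *\<^sub>R z n"
    using u unfolding block_multiples_def by simp metis
  define b where "b i = lim (\<lambda>k. a k i)" for i
  have "y n = b (\<beta> n) *\<^sub>R z n" for n
  proof -
    have "Cauchy (\<lambda>k. a k (\<beta> n) *\<^sub>R z n)"
      using y(2)[of n] by (simp add: a LIMSEQ_imp_Cauchy)
    then have "Cauchy (\<lambda>k. a k (\<beta> n))" using z by (rule Cauchy_scaleR_vector)
    then have "(\<lambda>k. a k (\<beta> n)) \<longlonglongrightarrow> b (\<beta> n)"
      by (simp add: b_def Cauchy_convergent flip: convergent_LIMSEQ_iff)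
    then have "(\<lambda>k. u k n) \<longlonglongrightarrow> b (\<beta> n) *\<^sub>R z n"
      by (simp add: a tendsto_scaleR)
    then show ?thesis using y(2) LIMSEQ_unique by blast
  qed
  then show ?thesis using y(1) by (auto simp: block_multiples_def)
qed

lemma closed_sublattice_block_multiples:
  fixes z :: "nat \<Rightarrow> 'g::banach_lattice"
  assumes "0 \<le> z" "\<And>n. z n \<noteq> 0"
  shows "closed_sublattice l_infty l_infty_norm (block_multiples \<beta> z)"
  unfolding closed_sublattice_def
proof (intro conjI ballI allI impI)
  show sub: "block_multiples \<beta> z \<subseteq> l_infty" by (auto simp: block_multiples_def)
  show "subspace (block_multiples \<beta> z)" by (rule subspace_block_multiples)
  show "s \<in> block_multiples \<beta> z"
    if "x \<in> block_multiples \<beta> z" "y \<in> block_multiples \<beta> z"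
      "sup_in l_infty x y s \<or> inf_in l_infty x y s" for x y s
    using that sub block_multiples_lattice[OF assms(1) that(1,2)]
    by (auto simp: sup_in_l_infty_iff inf_in_l_infty_iff subset_iff)
  show "y \<in> block_multiples \<beta> z"
    if y: "y \<in> l_infty" and
      u: "(\<forall>n. u n \<in> block_multiples \<beta> z) \<and> (\<lambda>n. l_infty_norm (u n - y)) \<longlonglongrightarrow> 0" for u y
  proof (rule block_multiples_closed[OF assms(2) _ y])
    show "u k \<in> block_multiples \<beta> z" for k using u by simp
    show "(\<lambda>k. u k n) \<longlonglongrightarrow> y n" for n
    proof (rule LIM_zero_cancel, rule Lim_null_comparison)
      have "u k - y \<in> l_infty" for k
        using u y sub by (auto intro: subspace_diff[OF subspace_l_infty])
      from norm_le_l_infty_norm[OF this, of _ n]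
      show "\<forall>\<^sub>F k in sequentially. norm (u k n - y n) \<le> l_infty_norm (u k - y)"
        by simp
    qed (use u in simp)
  qed
qed

text \<open>The restrictions of \<open>z\<close> to the blocks are independent, because at an entry of one block
  all the other restrictions vanish.\<close>

lemma infinite_dimensional_block_multiples:
  fixes z :: "nat \<Rightarrow> 'g::real_normed_vector"
  assumes "infinite (range \<beta>)" "z \<in> l_infty" "\<And>n. z n \<noteq> 0"
  shows "infinite_dimensional (block_multiples \<beta> z)"
proof -
  define e where "e i = (\<lambda>n. (if \<beta> n = i then 1 else 0) *\<^sub>R z n)" for i
  obtain M where M: "norm (z n) \<le> M" for n
    using assms(2) by (auto simp: l_infty_def bounded_iff)
  have "norm (e i n) \<le> M" for i n
    using M[of n] order_trans[OF norm_ge_zero M[of n]] by (simp add: e_def)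
  then have "e i \<in> l_infty" for i
    unfolding l_infty_def bounded_iff by blast
  then have e: "e i \<in> block_multiples \<beta> z" for i
    by (auto simp: block_multiples_def e_def
        intro!: exI[of _ "\<lambda>j. if j = i then 1 else 0"])
  have nonzero: "e (\<beta> n) n \<noteq> 0" for n using assms(3) by (simp add: e_def)
  have zero: "e (\<beta> m) n = 0" if "\<beta> m \<noteq> \<beta> n" for m n using that by (simp add: e_def)
  have inj: "inj_on e (range \<beta>)"
    by (rule inj_onI) (metis nonzero zero rangeE)
  have indep: "independent (e ` range \<beta>)"
    unfolding dependent_def
  proof safe
    fix n assume *: "e (\<beta> n) \<in> span (e ` range \<beta> - {e (\<beta> n)})"
    have "span (e ` range \<beta> - {e (\<beta> n)}) \<subseteq> {f. f n = 0}"
    proof (rule span_minimal)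
      show "e ` range \<beta> - {e (\<beta> n)} \<subseteq> {f. f n = 0}" using zero by auto metis
      show "subspace {f :: nat \<Rightarrow> 'g. f n = 0}"
        by (rule subspaceI) (simp_all add: scaleR_fun_def)
    qed
    then show False using * nonzero by auto
  qed
  show ?thesis
    unfolding infinite_dimensional_def
  proof
    assume "\<exists>S. finite S \<and> block_multiples \<beta> z \<subseteq> span S"
    then obtain S where "finite S" "e ` range \<beta> \<subseteq> span S" using e by blast
    then have "finite (e ` range \<beta>)" using independent_span_bound indep by blast
    then show False using assms(1) finite_imageD inj by blast
  qed
qed

lemma disjoint_seq_block_multiples:
  fixes z :: "nat \<Rightarrow> 'g::banach_lattice"
  assumes "disjoint_seq z" "y \<in> block_multiples \<beta> z"
  shows "disjoint_seq y"
  using assms by (auto simp: disjoint_seq_def block_multiples_def disjoint_scaleR)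

text \<open>A nonzero coefficient on one block already prevents weak nullity, because the block supplies
  arbitrarily large indices.\<close>

lemma not_weakly_null_block_multiples:
  fixes z :: "nat \<Rightarrow> 'g::real_normed_vector" and \<phi> :: "'g \<Rightarrow>\<^sub>L real"
  assumes \<beta>: "\<And>i. i \<in> range \<beta> \<Longrightarrow> infinite {n. \<beta> n = i}"
    and \<phi>: "0 < \<delta>" "\<And>n. \<delta> \<le> \<bar>blinfun_apply \<phi> (z n)\<bar>"
    and y: "y \<in> block_multiples \<beta> z" "y \<noteq> 0"
  shows "\<not> weakly_null y"
proof
  assume "weakly_null y"
  then have lim: "(\<lambda>n. blinfun_apply \<phi> (y n)) \<longlonglongrightarrow> 0" by (simp add: weakly_null_def)
  obtain a where a: "\<And>n. y n = a (\<beta> n) *\<^sub>R z n"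
    using y(1) by (auto simp: block_multiples_def)
  obtain m where "y m \<noteq> 0" using y(2) by (auto simp: fun_eq_iff)
  then have am: "a (\<beta> m) \<noteq> 0" by (auto simp: a)
  then have "0 < \<bar>a (\<beta> m)\<bar> * \<delta>" using \<phi>(1) by simp
  then obtain N where N: "\<And>n. N \<le> n \<Longrightarrow> \<bar>blinfun_apply \<phi> (y n)\<bar> < \<bar>a (\<beta> m)\<bar> * \<delta>"
    using LIMSEQ_D[OF lim] by fastforce
  obtain n where n: "N \<le> n" "\<beta> n = \<beta> m"
    using \<beta>[of "\<beta> m"] by (auto simp: infinite_nat_iff_unbounded_le)
  have "\<bar>a (\<beta> m)\<bar> * \<delta> \<le> \<bar>blinfun_apply \<phi> (y n)\<bar>"
    using \<phi>(2)[of n] by (simp add: a n blinfun.scaleR_right abs_mult mult_left_mono)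
  then show False using N n by fastforce
qed


section \<open>Sequences that are not weakly null\<close>

lemma not_weakly_null_subseq:
  fixes x :: "nat \<Rightarrow> 'g::real_normed_vector"
  assumes "\<not> weakly_null x"
  obtains \<delta> :: real and r :: "nat \<Rightarrow> nat" and \<phi> :: "'g \<Rightarrow>\<^sub>L real" where
    "0 < \<delta>" "strict_mono r"
    "\<forall>n. \<delta> \<le> \<bar>blinfun_apply \<phi> (x (r n))\<bar>"
proof -
  obtain \<phi> :: "'g \<Rightarrow>\<^sub>L real" where "\<not> (\<lambda>n. blinfun_apply \<phi> (x n)) \<longlonglongrightarrow> 0"
    using assms by (auto simp: weakly_null_def)
  then obtain \<delta> where \<delta>: "0 < \<delta>" "\<And>N. \<exists>n\<ge>N. \<delta> \<le> \<bar>blinfun_apply \<phi> (x n)\<bar>"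
    by (auto simp: LIMSEQ_iff not_less)
  then have "infinite {n. \<delta> \<le> \<bar>blinfun_apply \<phi> (x n)\<bar>}"
    by (auto simp: infinite_nat_iff_unbounded_le)
  then obtain r :: "nat \<Rightarrow> nat" where "strict_mono r" "\<And>n. \<delta> \<le> \<bar>blinfun_apply \<phi> (x (r n))\<bar>"
    using infinite_enumerate by blast
  then show ?thesis using \<delta>(1) that by blast
qed

lemma abs_blinfun_apply_le:
  fixes \<phi> :: "'g::banach_lattice \<Rightarrow>\<^sub>L real"
  shows "\<bar>blinfun_apply \<phi> v\<bar> \<le> blinfun_apply \<bar>\<phi>\<bar> \<bar>v\<bar>"
proof -
  have le: "blinfun_apply \<phi> w \<le> blinfun_apply \<bar>\<phi>\<bar> w" "- blinfun_apply \<phi> w \<le> blinfun_apply \<bar>\<phi>\<bar> w"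
    if "0 \<le> w" for w
    using abs_ge_self[of \<phi>] abs_ge_minus_self[of \<phi>] that
    by (auto simp: less_eq_blinfun_def blinfun.minus_left)
  have 1: "blinfun_apply \<phi> v = blinfun_apply \<phi> (pprt v) - blinfun_apply \<phi> (pprt (- v))"
    by (subst pos_diff[of v]) (simp add: blinfun.diff_right)
  have "\<bar>v\<bar> = pprt v + pprt (- v)" by (simp add: abs_prts pprt_neg)
  then have 2: "blinfun_apply \<bar>\<phi>\<bar> \<bar>v\<bar> = blinfun_apply \<bar>\<phi>\<bar> (pprt v) + blinfun_apply \<bar>\<phi>\<bar> (pprt (- v))"
    by (simp add: blinfun.add_right)
  show ?thesis
    using le[of "pprt v"] le[of "pprt (- v)"] unfolding 1 2 abs_le_iff by simp
qed

lemma weakly_null_if_abs: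
  fixes x :: "nat \<Rightarrow> 'g::banach_lattice"
  assumes "weakly_null (\<lambda>n. \<bar>x n\<bar>)"
  shows "weakly_null x"
  unfolding weakly_null_def
proof
  fix \<phi> :: "'g \<Rightarrow>\<^sub>L real"
  have "(\<lambda>n. blinfun_apply \<bar>\<phi>\<bar> \<bar>x n\<bar>) \<longlonglongrightarrow> 0"
    using assms by (simp add: weakly_null_def)
  then show "(\<lambda>n. blinfun_apply \<phi> (x n)) \<longlonglongrightarrow> 0"
    by (rule Lim_null_comparison[rotated]) (simp add: abs_blinfun_apply_le)
qed


section \<open>Latticeability\<close>

text \<open>The lattice consists of the blockwise multiples of a subsequence on which one functional stays
  away from zero; its only weakly null element is zero.\<close>

theorem disjoint_non_weakly_null_latticeable:
  fixes x :: "nat \<Rightarrow> 'g::banach_lattice"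
  assumes "bounded (range x)" "disjoint_seq x" "\<not> weakly_null x" "0 \<le> x"
  obtains Y r where "closed_sublattice l_infty l_infty_norm Y" "infinite_dimensional Y"
    "Y \<subseteq> {x. bounded (range x) \<and> disjoint_seq x \<and> \<not> weakly_null x} \<union> {0}"
    "strict_mono r" "x \<circ> r \<in> Y"
proof -
  obtain \<delta> :: real and r :: "nat \<Rightarrow> nat" and \<phi> :: "'g \<Rightarrow>\<^sub>L real" where \<phi>: "0 < \<delta>" "strict_mono r"
    "\<forall>n. \<delta> \<le> \<bar>blinfun_apply \<phi> (x (r n))\<bar>"
    using not_weakly_null_subseq[OF assms(3)] .
  define z where "z = x \<circ> r"
  have \<phi>z: "\<delta> \<le> \<bar>blinfun_apply \<phi> (z n)\<bar>" for n using \<phi>(3) by (simp add: z_def)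
  have z0: "z n \<noteq> 0" for n using \<phi>z[of n] \<phi>(1) by (auto simp: blinfun.zero_right)
  have zpos: "0 \<le> z" using assms(4) by (simp add: z_def le_fun_def)
  have zbdd: "z \<in> l_infty"
    using assms(1) by (auto simp: l_infty_def z_def intro: bounded_subset)
  have zdis: "disjoint_seq z"
    using assms(2) strict_mono_eq[OF \<phi>(2)] by (simp add: disjoint_seq_def z_def)
  \<comment> \<open>A map from \<open>nat\<close> onto \<open>nat\<close> with infinite fibres.\<close>
  define \<beta> :: "nat \<Rightarrow> nat" where "\<beta> n = fst (prod_decode n)" for n
  have \<beta>: "infinite {n. \<beta> n = i}" for i
  proof (rule infinite_super)
    show "range (\<lambda>j. prod_encode (i, j)) \<subseteq> {n. \<beta> n = i}" by (auto simp: \<beta>_def)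
    have "inj (\<lambda>j. prod_encode (i, j))" by (auto intro!: injI)
    then show "infinite (range (\<lambda>j. prod_encode (i, j)))" by (rule range_inj_infinite)
  qed
  have "surj \<beta>" by (metis \<beta> surjI \<beta>_def prod_encode_inverse fst_conv)
  then have range: "infinite (range \<beta>)" by simp
  show ?thesis
  proof (rule that)
    show "closed_sublattice l_infty l_infty_norm (block_multiples \<beta> z)"
      using zpos z0 by (rule closed_sublattice_block_multiples)
    show "infinite_dimensional (block_multiples \<beta> z)"
      using range zbdd z0 by (rule infinite_dimensional_block_multiples)
    show "block_multiples \<beta> z \<subseteq> {x. bounded (range x) \<and> disjoint_seq x \<and> \<not> weakly_null x} \<union> {0}"
      using disjoint_seq_block_multiples[OF zdis]
        not_weakly_null_block_multiples[of \<beta> \<delta> \<phi> z, OF \<beta> \<phi>(1) \<phi>z]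
      by (auto simp: block_multiples_def l_infty_def)
    show "x \<circ> r \<in> block_multiples \<beta> z"
      using block_multiples_self[OF zbdd] by (simp add: z_def)
  qed (rule \<phi>(2))
qed

theorem corollary4p6:
  assumes "\<not> disjoint_Grothendieck TYPE('a::banach_lattice)"
  shows "almost_positive_pointwise_latticeable l_infty l_infty_norm
           {x :: nat \<Rightarrow> ('a \<Rightarrow>\<^sub>L real). bounded (range x) \<and> disjoint_seq x \<and> \<not> weakly_null x}"
    (is "almost_positive_pointwise_latticeable _ _ ?B")
  unfolding almost_positive_pointwise_latticeable_def
proof (intro conjI ballI impI)
  show "banach_sequence_lattice (l_infty :: (nat \<Rightarrow> 'a \<Rightarrow>\<^sub>L real) set) l_infty_norm"
    by (rule banach_sequence_lattice_l_infty)
  show "?B \<subseteq> l_infty" by (auto simp: l_infty_def)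
  obtain x :: "nat \<Rightarrow> 'a \<Rightarrow>\<^sub>L real" where
    x: "bounded (range x)" "disjoint_seq x" "\<not> weakly_null x"
    using assms by (auto simp: disjoint_Grothendieck_def)
  have "(\<lambda>n. \<bar>x n\<bar>) \<in> ?B"
    using x weakly_null_if_abs[of x] by (auto simp: bounded_iff disjoint_seq_def)
  then show "\<exists>x\<in>?B. 0 \<le> x" by (rule bexI[rotated]) (simp add: le_fun_def)
  show "\<exists>Y. closed_sublattice l_infty l_infty_norm Y \<and> infinite_dimensional Y \<and>
      Y \<subseteq> ?B \<union> {0} \<and> (\<exists>r. strict_mono r \<and> x \<circ> r \<in> Y)" if "x \<in> ?B" "0 \<le> x" for x
    using that disjoint_non_weakly_null_latticeable[of x] by (metis (no_types, lifting) mem_Collect_eq)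
qed

end
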